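(* Let $\Omega$ be an SMT formula written as $\Omega = \Psi \wedge \Phi$, where $\Psi$ is its Boolean skeleton over Boolean skeleton variables and $\Phi$ is the set of consistency constraints. Fix an ordering $P_1, \ldots, P_r$ of the Boolean skeleton variables, and let $\theta_1, \ldots, \theta_n$ be symmetries of $\Psi \wedge \Phi$. For each symmetry $\theta$, define the restricted symmetry breaking predicate $$SBP(\theta) \;=\; \bigwedge_{1 \le i \le r} \Big( \big(\textstyle\bigwedge_{1 \le j < i} P_j \leftrightarrow \theta(P_j)\big) \Rightarrow \big(P_i \Rightarrow \theta(P_i)\big)\Big),$$ and set $\Psi' = \Psi \wedge SBP(\theta_1) \wedge \cdots \wedge SBP(\theta_n)$. Then $\Psi' \wedge \Phi$ and $\Psi \wedge \Phi$ are equisatisfiable, i.e. one is satisfiable if and only if the other is.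
   Context: An SMT formula combines operations (arithmetic, comparisons, equalities, etc.) over typed non-Boolean theory variables (e.g. integers, reals) with Boolean connectives. Its Boolean skeleton $\Psi$ is obtained by replacing each atomic Boolean expression (e.g. $x+y>2$) by a fresh Boolean variable (a Boolean skeleton variable); the consistency constraints $\Phi$ are the conjunction of the equivalences $P \Leftrightarrow a$ linking each Boolean skeleton variable $P$ to the atomic expression $a$ it replaces. Thus $\Omega$ is satisfiable iff $\Psi\wedge\Phi$ is satisfiable. A symmetry of $\Psi \wedge \Phi$ is a permutation $\theta$ acting simultaneously on the Boolean skeleton variables and the theory variables, mapping each variable to a variable of the same type, such that simultaneously replacing every variable $v$ in $\Psi \wedge \Phi$ by $\theta(v)$ yields $\Psi \wedge \Phi$ again (the same set of constraints). The same ordering $P_1,\dots,P_r$ is used for all the symmetries $\theta_1,\dots,\theta_n$. *)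

theory Defs
  imports "HOL-Library.Multiset" "HOL-Library.FSet" "HOL-Combinatorics.Permutations"
begin

text \<open>
  Applying a symmetry to a formula must give the \<^emph>\<open>same\<close> formula, so the syntax identifies
  expressions that differ only in the order of arguments of commutative operations: conjunctions and
  disjunctions have sets of operands, and an operation or relation symbol may be applied either
  to a list of arguments (e.g. subtraction, order) or to a multiset (e.g. addition, equality).
\<close>

datatype 't args = Ordered "'t list" | Unordered "'t multiset"

datatype (dead 'f, vars_trm: 'v) trm =
    Var 'v
  | Op 'f "('f, 'v) trm args"
for map: rename_trm

datatype (dead 'f, dead 'p, vars_atom: 'v) atom = Pred 'p "('f, 'v) trm args"
for map: rename_atom

text \<open>\<open>Conj {||}\<close> is truth and \<open>Disj {||}\<close> is falsity.\<close>

datatype (leaves: 'a) fm =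
    Leaf 'a
  | Neg "'a fm"
  | Conj "'a fm fset"
  | Disj "'a fm fset"
  | Impl "'a fm" "'a fm"
for map: map_fm

definition Iff :: "'a fm \<Rightarrow> 'a fm \<Rightarrow> 'a fm" where
  "Iff A B = Conj {|Impl A B, Impl B A|}"

text \<open>
  An SMT formula has type \<open>('f, 'p, 'v) atom fm\<close>. Its skeleton and its consistency constraints
  have type \<open>('f, 'p, 'v) constraint\<close>, where Boolean variables occur next to atoms.
\<close>

datatype (dead 'f, dead 'p, vars_leaf: 'v) leaf =
    BVar 'v
  | Atom "('f, 'p, 'v) atom"
for map: rename_leaf

type_synonym ('f, 'p, 'v) constraint = "('f, 'p, 'v) leaf fm"

definition vars :: "('f, 'p, 'v) constraint \<Rightarrow> 'v set" where
  "vars c = (\<Union>l \<in> leaves c. vars_leaf l)"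

definition rename :: "('v \<Rightarrow> 'v) \<Rightarrow> ('f, 'p, 'v) constraint \<Rightarrow> ('f, 'p, 'v) constraint" where
  "rename \<theta> = map_fm (rename_leaf \<theta>)"

text \<open>
  Interpretations are total on the universe \<open>'d\<close>; only the values of variables are confined
  to the domain of their sort. No well-sortedness of terms is required.
\<close>

datatype 's ty = BoolT | Sort 's

record ('f, 'p, 's, 'd) interp =
  dom_of :: "'s \<Rightarrow> 'd set"
  op_of :: "'f \<Rightarrow> 'd args \<Rightarrow> 'd"
  pred_of :: "'p \<Rightarrow> 'd args \<Rightarrow> bool"

primrec eval_trm :: "('f, 'p, 's, 'd) interp \<Rightarrow> ('v \<Rightarrow> 'd) \<Rightarrow> ('f, 'v) trm \<Rightarrow> 'd" where
  "eval_trm M \<sigma> (Var x) = \<sigma> x"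
| "eval_trm M \<sigma> (Op f ts) = op_of M f (map_args (eval_trm M \<sigma>) ts)"

primrec eval_atom :: "('f, 'p, 's, 'd) interp \<Rightarrow> ('v \<Rightarrow> 'd) \<Rightarrow> ('f, 'p, 'v) atom \<Rightarrow> bool" where
  "eval_atom M \<sigma> (Pred p ts) = pred_of M p (map_args (eval_trm M \<sigma>) ts)"

primrec eval_leaf ::
  "('f, 'p, 's, 'd) interp \<Rightarrow> ('v \<Rightarrow> bool) \<Rightarrow> ('v \<Rightarrow> 'd) \<Rightarrow> ('f, 'p, 'v) leaf \<Rightarrow> bool" where
  "eval_leaf M \<beta> \<sigma> (BVar v) = \<beta> v"
| "eval_leaf M \<beta> \<sigma> (Atom a) = eval_atom M \<sigma> a"

primrec eval_fm :: "('a \<Rightarrow> bool) \<Rightarrow> 'a fm \<Rightarrow> bool" where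
  "eval_fm h (Leaf a) = h a"
| "eval_fm h (Neg A) = (\<not> eval_fm h A)"
| "eval_fm h (Conj F) = (\<forall>b |\<in>| eval_fm h |`| F. b)"
| "eval_fm h (Disj F) = (\<exists>b |\<in>| eval_fm h |`| F. b)"
| "eval_fm h (Impl A B) = (eval_fm h A \<longrightarrow> eval_fm h B)"

definition well_typed_valuation ::
  "('v \<Rightarrow> 's ty) \<Rightarrow> ('f, 'p, 's, 'd) interp \<Rightarrow> ('v \<Rightarrow> 'd) \<Rightarrow> bool" where
  "well_typed_valuation ty M \<sigma> \<longleftrightarrow> (\<forall>x s. ty x = Sort s \<longrightarrow> \<sigma> x \<in> dom_of M s)"

text \<open>
  Satisfiability modulo a theory, given as its set \<open>T\<close> of admissible interpretations: a
  singleton for, say, integer arithmetic, a larger set in the presence of uninterpreted symbols.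
\<close>

definition satisfiable ::
  "('v \<Rightarrow> 's ty) \<Rightarrow> ('f, 'p, 's, 'd) interp set \<Rightarrow> ('f, 'p, 'v) constraint set \<Rightarrow> bool" where
  "satisfiable ty T C \<longleftrightarrow>
    (\<exists>M \<in> T. \<exists>\<beta> \<sigma>. well_typed_valuation ty M \<sigma> \<and> (\<forall>c \<in> C. eval_fm (eval_leaf M \<beta> \<sigma>) c))"

text \<open>\<open>sk a\<close> is the Boolean skeleton variable that replaces the atom \<open>a\<close>.\<close>

definition skeleton ::
  "(('f, 'p, 'v) atom \<Rightarrow> 'v) \<Rightarrow> ('f, 'p, 'v) atom fm \<Rightarrow> ('f, 'p, 'v) constraint" where
  "skeleton sk \<Omega> = map_fm (\<lambda>a. BVar (sk a)) \<Omega>"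

definition consistency ::
  "(('f, 'p, 'v) atom \<Rightarrow> 'v) \<Rightarrow> ('f, 'p, 'v) atom fm \<Rightarrow> ('f, 'p, 'v) constraint set" where
  "consistency sk \<Omega> = {Iff (Leaf (BVar (sk a))) (Leaf (Atom a)) | a. a \<in> leaves \<Omega>}"

definition symmetry ::
  "('v \<Rightarrow> 's ty) \<Rightarrow> ('f, 'p, 'v) constraint set \<Rightarrow> ('v \<Rightarrow> 'v) \<Rightarrow> bool" where
  "symmetry ty C \<theta> \<longleftrightarrow>
    \<theta> permutes (\<Union>c \<in> C. vars c) \<and>
    (\<forall>v \<in> (\<Union>c \<in> C. vars c). ty (\<theta> v) = ty v) \<and>
    rename \<theta> ` C = C"

text \<open>The variables are indexed from 0 here.\<close>

definition SBP :: "'v list \<Rightarrow> ('v \<Rightarrow> 'v) \<Rightarrow> ('f, 'p, 'v) constraint" where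
  "SBP Ps \<theta> =
    Conj ((\<lambda>i. Impl
        (Conj ((\<lambda>j. Iff (Leaf (BVar (Ps ! j))) (Leaf (BVar (\<theta> (Ps ! j))))) |`| fset_of_list [0..<i]))
        (Impl (Leaf (BVar (Ps ! i))) (Leaf (BVar (\<theta> (Ps ! i))))))
      |`| fset_of_list [0..<length Ps])"

end

theory Submission imports Defs begin

text \<open>
  A symmetry \<open>\<theta>\<close> maps every model \<open>(\<beta>, \<sigma>)\<close> of \<open>\<Psi> \<and> \<Phi>\<close> to the model \<open>(\<beta> \<circ> \<theta>, \<sigma> \<circ> \<theta>)\<close> over the
  same interpretation, and \<open>SBP(\<theta>)\<close> says that the vector \<open>\<beta>(P\<^sub>1), \<dots>, \<beta>(P\<^sub>r)\<close> is lexicographically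
  at most that of \<open>\<beta> \<circ> \<theta>\<close>. As all symmetries share the ordering of the variables, a model with a
  lexicographically minimal vector satisfies all the predicates at once.
\<close>

text \<open>A renamed variable \<open>\<theta> x\<close> is looked up as
  \<open>\<sigma> (\<theta> x)\<close>, so renaming the syntax amounts to precomposing the valuation
  with \<open>\<theta>\<close> itself, not with its inverse.\<close>

lemma eval_trm_rename: "eval_trm M \<sigma> (rename_trm \<theta> t) = eval_trm M (\<sigma> \<circ> \<theta>) t"
proof (induction t)
  case (Op f ts)
  \<comment> \<open>The induction hypothesis speaks of single arguments; congruence of
    \<open>map_args\<close> lifts it to lists and multisets alike.\<close>
  then have "map_args (eval_trm M \<sigma> \<circ> rename_trm \<theta>) ts = map_args (eval_trm M (\<sigma> \<circ> \<theta>)) ts"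
    by (intro args.map_cong) (auto simp: comp_def)
  then show ?case by (simp only: trm.map eval_trm.simps args.map_comp)
qed simp

lemma eval_atom_rename: "eval_atom M \<sigma> (rename_atom \<theta> a) = eval_atom M (\<sigma> \<circ> \<theta>) a"
proof (cases a)
  case (Pred p ts)
  have "map_args (eval_trm M \<sigma> \<circ> rename_trm \<theta>) ts = map_args (eval_trm M (\<sigma> \<circ> \<theta>)) ts"
    by (intro args.map_cong) (auto simp: eval_trm_rename)
  then show ?thesis by (simp add: Pred args.map_comp)
qed

lemma eval_leaf_rename: "eval_leaf M \<beta> \<sigma> (rename_leaf \<theta> l) = eval_leaf M (\<beta> \<circ> \<theta>) (\<sigma> \<circ> \<theta>) l"
  by (cases l) (simp_all add: eval_atom_rename)

lemma eval_fm_map_fm: "eval_fm h (map_fm g A) = eval_fm (h \<circ> g) A"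
  by (induction A) auto

lemma eval_fm_rename:
  "eval_fm (eval_leaf M \<beta> \<sigma>) (rename \<theta> c) = eval_fm (eval_leaf M (\<beta> \<circ> \<theta>) (\<sigma> \<circ> \<theta>)) c"
proof -
  have "eval_leaf M \<beta> \<sigma> \<circ> rename_leaf \<theta> = eval_leaf M (\<beta> \<circ> \<theta>) (\<sigma> \<circ> \<theta>)"
    by (simp add: fun_eq_iff eval_leaf_rename)
  then show ?thesis by (simp add: rename_def eval_fm_map_fm)
qed

lemma eval_fm_Iff: "eval_fm h (Iff A B) \<longleftrightarrow> (eval_fm h A \<longleftrightarrow> eval_fm h B)"
  by (auto simp: Iff_def)

lemma eval_fm_SBP:
  "eval_fm (eval_leaf M \<beta> \<sigma>) (SBP Ps \<theta>) \<longleftrightarrow>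
    (\<forall>i<length Ps. (\<forall>j<i. \<beta> (Ps ! j) = \<beta> (\<theta> (Ps ! j))) \<longrightarrow> \<beta> (Ps ! i) \<longrightarrow> \<beta> (\<theta> (Ps ! i)))"
  by (simp add: SBP_def eval_fm_Iff fset_of_list.rep_eq) (simp add: Ball_def)

text \<open>\<open>M\<close> is a parameter because a symmetry changes only the valuations:
  minimization takes place over one fixed interpretation.\<close>

definition is_model ::
  "('v \<Rightarrow> 's ty) \<Rightarrow> ('f, 'p, 's, 'd) interp \<Rightarrow> ('f, 'p, 'v) constraint set \<Rightarrow>
    ('v \<Rightarrow> bool) \<Rightarrow> ('v \<Rightarrow> 'd) \<Rightarrow> bool" where
  "is_model ty M C \<beta> \<sigma> \<longleftrightarrow>
    well_typed_valuation ty M \<sigma> \<and> (\<forall>c \<in> C. eval_fm (eval_leaf M \<beta> \<sigma>) c)"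

lemma satisfiable_iff_is_model: "satisfiable ty T C \<longleftrightarrow> (\<exists>M \<in> T. \<exists>\<beta> \<sigma>. is_model ty M C \<beta> \<sigma>)"
  by (simp add: satisfiable_def is_model_def)

text \<open>Outside the occurring variables \<open>\<theta>\<close> is the identity. The claim
  covers all \<open>x\<close> because \<open>well_typed_valuation\<close> constrains every
  variable.\<close>

lemma symmetry_preserves_type:
  assumes "symmetry ty C \<theta>"
  shows "ty (\<theta> x) = ty x"
proof (cases "x \<in> (\<Union>c \<in> C. vars c)")
  case True
  then show ?thesis using assms unfolding symmetry_def by blast
next
  case False
  have "\<theta> permutes (\<Union>c \<in> C. vars c)" using assms by (simp add: symmetry_def)
  then show ?thesis by (simp only: permutes_not_in[OF _ False])
qed

text \<open>The truth of \<open>c\<close> under the composed valuations is that of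
  \<open>rename \<theta> c\<close> under the original ones, and \<open>C\<close> contains this
  renamed constraint.\<close>

lemma is_model_symmetry:
  assumes "symmetry ty C \<theta>" and "is_model ty M C \<beta> \<sigma>"
  shows "is_model ty M C (\<beta> \<circ> \<theta>) (\<sigma> \<circ> \<theta>)"
proof -
  have "rename \<theta> c \<in> C" if "c \<in> C" for c
    using assms(1) that unfolding symmetry_def by blast
  then show ?thesis
    using assms(2) symmetry_preserves_type[OF assms(1)]
    by (auto simp: is_model_def well_typed_valuation_def simp flip: eval_fm_rename)
qed

text \<open>Both lists have the length of \<open>xs\<close>, so \<open>lenlex\<close> compares them
  lexicographically, and position \<open>i\<close> decides after a common prefix.\<close>

lemma map_in_lenlexI:
  assumes i: "i < length xs" and eq: "\<And>j. j < i \<Longrightarrow> f (xs ! j) = g (xs ! j)"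
    and r: "(f (xs ! i), g (xs ! i)) \<in> r"
  shows "(map f xs, map g xs) \<in> lenlex r"
proof -
  have split: "map h xs = map h (take i xs) @ h (xs ! i) # map h (drop (Suc i) xs)" for h :: "'a \<Rightarrow> 'b"
    using arg_cong[OF id_take_nth_drop[OF i], of "map h"] by simp
  have "map f (take i xs) = map g (take i xs)"
    using eq i by (auto simp: list_eq_iff_nth_eq)
  then have "(map f xs, map g xs) \<in> lex r"
    unfolding split[of f] split[of g] using r by (simp only:) (intro lex_append_leftI, simp)
  then show ?thesis by (simp add: lenlex_conv)
qed

text \<open>The set of vectors to be minimized depends on no particular symmetry, so the model can
  be chosen before \<open>\<theta>\<close>.\<close>

lemma exists_model_SBP:
  assumes "is_model ty M C \<beta>\<^sub>0 \<sigma>\<^sub>0"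
  shows "\<exists>\<beta> \<sigma>. is_model ty M C \<beta> \<sigma> \<and>
    (\<forall>\<theta>. symmetry ty C \<theta> \<longrightarrow> eval_fm (eval_leaf M \<beta> \<sigma>) (SBP Ps \<theta>))"
proof -
  \<comment> \<open>\<open>False\<close> lies below \<open>True\<close>, matching the implication
    from \<open>P\<close> to its image in \<open>SBP\<close>.\<close>
  let ?less = "lenlex {(False, True)}"
  let ?V = "{map \<beta> Ps | \<beta> \<sigma>. is_model ty M C \<beta> \<sigma>}"
  have "wf ?less" by (intro wf_lenlex wf_insert[THEN iffD2]) auto
  moreover have "map \<beta>\<^sub>0 Ps \<in> ?V" using assms by blast
  ultimately obtain v where v: "v \<in> ?V" and min: "\<And>w. (w, v) \<in> ?less \<Longrightarrow> w \<notin> ?V"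
    by (rule wfE_min) blast
  obtain \<beta> \<sigma> where mod: "is_model ty M C \<beta> \<sigma>" and v_eq: "v = map \<beta> Ps"
    using v by blast
  have "eval_fm (eval_leaf M \<beta> \<sigma>) (SBP Ps \<theta>)" if sym: "symmetry ty C \<theta>" for \<theta>
  proof (rule ccontr)
    assume "\<not> ?thesis"
    then obtain i where "i < length Ps" and "\<forall>j<i. \<beta> (Ps ! j) = \<beta> (\<theta> (Ps ! j))"
      and "\<beta> (Ps ! i)" and "\<not> \<beta> (\<theta> (Ps ! i))"
      unfolding eval_fm_SBP by blast
    \<comment> \<open>A violated conjunct of \<open>SBP\<close> yields the first difference of the
      two vectors, with \<open>False\<close> in the vector of
      \<open>\<beta> \<circ> \<theta>\<close>: the image model would be strictly smaller.\<close>
    then have "(map (\<beta> \<circ> \<theta>) Ps, v) \<in> ?less"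
      unfolding v_eq by (intro map_in_lenlexI) auto
    moreover have "map (\<beta> \<circ> \<theta>) Ps \<in> ?V"
      using is_model_symmetry[OF sym mod] by blast
    ultimately show False using min by blast
  qed
  then show ?thesis using mod by blast
qed

theorem theorem2:
  fixes ty :: "'v \<Rightarrow> 's ty"
    and T :: "('f, 'p, 's, 'd) interp set"
    and \<Omega> :: "('f, 'p, 'v) atom fm"
    and sk :: "('f, 'p, 'v) atom \<Rightarrow> 'v"
    and \<Psi> \<Psi>' :: "('f, 'p, 'v) constraint"
    and \<Phi> :: "('f, 'p, 'v) constraint set"
    and Ps :: "'v list"
    and \<theta>s :: "('v \<Rightarrow> 'v) list"
  assumes theory_vars: "\<And>a x. a \<in> leaves \<Omega> \<Longrightarrow> x \<in> vars_atom a \<Longrightarrow> ty x \<noteq> BoolT"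
    and skeleton_vars: "\<And>a. a \<in> leaves \<Omega> \<Longrightarrow> ty (sk a) = BoolT"
    and fresh: "inj_on sk (leaves \<Omega>)"
    and \<Psi>: "\<Psi> = skeleton sk \<Omega>"
    and \<Phi>: "\<Phi> = consistency sk \<Omega>"
    and ordering: "distinct Ps" "set Ps = sk ` leaves \<Omega>"
    and symmetries: "\<And>\<theta>. \<theta> \<in> set \<theta>s \<Longrightarrow> symmetry ty (insert \<Psi> \<Phi>) \<theta>"
    and \<Psi>': "\<Psi>' = Conj (finsert \<Psi> (fset_of_list (map (SBP Ps) \<theta>s)))"
  shows "satisfiable ty T (insert \<Psi>' \<Phi>) \<longleftrightarrow> satisfiable ty T (insert \<Psi> \<Phi>)"
proof -
  have is_model_\<Psi>': "is_model ty M (insert \<Psi>' \<Phi>) \<beta> \<sigma> \<longleftrightarrow>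
      is_model ty M (insert \<Psi> \<Phi>) \<beta> \<sigma> \<and>
      (\<forall>\<theta> \<in> set \<theta>s. eval_fm (eval_leaf M \<beta> \<sigma>) (SBP Ps \<theta>))"
    for M :: "('f, 'p, 's, 'd) interp" and \<beta> \<sigma>
    by (auto simp: is_model_def \<Psi>' fset_of_list.rep_eq)
  \<comment> \<open>One direction forgets the predicates; the other replaces the given model by a
    minimal one over the same \<open>M\<close>.\<close>
  show ?thesis
    unfolding satisfiable_iff_is_model is_model_\<Psi>'
    using exists_model_SBP[of ty _ "insert \<Psi> \<Phi>" _ _ Ps] symmetries by blast
qed

end
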